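(* Let $f$ and $g$ be representable positive functionals on the (not necessarily unital) $^*$-algebra $\mathscr{A}$. Let $(H_f,\pi_f,\zeta_f)$ and $(H_g,\pi_g,\zeta_g)$ be the GNS-triples associated with $f$ and $g$, respectively, and let $\pi:=\pi_f\oplus\pi_g$. Then the closure of the subspace $$\{\pi_f(a)\zeta_f\oplus\pi_g(a)\zeta_g : a\in\mathscr{A}\}\subseteq H_f\oplus H_g$$ is $\pi$-invariant. If $P$ denotes the orthogonal projection of $H_f\oplus H_g$ onto the orthogonal complement of this subspace, then the representable functional $f:g$ defined by $$(f:g)(a):=(\pi(a)P(\zeta_f\oplus0)\mid P(\zeta_f\oplus0)),\qquad a\in\mathscr{A},$$ satisfies $$(f:g)(a^*a)=\inf\{f((a-b)^*(a-b))+g(b^*b):b\in\mathscr{A}\},\qquad a\in\mathscr{A}.$$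
   Context: $\mathscr{A}$ is a complex $^*$-algebra. A linear functional $f$ on $\mathscr{A}$ is positive if $f(a^*a)\ge0$ for all $a\in\mathscr{A}$, and representable if there are a Hilbert space $H$, a $^*$-representation $\pi$ of $\mathscr{A}$ in $\mathscr{B}(H)$ and $\zeta\in H$ with $f(a)=(\pi(a)\zeta\mid\zeta)$ for all $a\in\mathscr{A}$. The GNS-triple $(H_f,\pi_f,\zeta_f)$ of a representable positive functional $f$ consists of a Hilbert space $H_f$, a $^*$-representation $\pi_f:\mathscr{A}\to\mathscr{B}(H_f)$ and a cyclic vector $\zeta_f\in H_f$ (i.e. $\{\pi_f(a)\zeta_f:a\in\mathscr{A}\}$ is dense in $H_f$) such that $f(a)=(\pi_f(a)\zeta_f\mid\zeta_f)_f$ for all $a\in\mathscr{A}$. Inner products are linear in the first variable. A subspace $M$ is $\pi$-invariant if $\pi(a)M\subseteq M$ for all $a\in\mathscr{A}$. *)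

theory Defs
  imports "HOL-Analysis.Analysis"
begin

class complex_vector = ab_group_add +
  fixes scaleC :: "complex \<Rightarrow> 'a \<Rightarrow> 'a"  (infixr \<open>*\<^sub>C\<close> 75)
  assumes scaleC_add_right: "c *\<^sub>C (x + y) = c *\<^sub>C x + c *\<^sub>C y"
    and scaleC_add_left: "(c + d) *\<^sub>C x = c *\<^sub>C x + d *\<^sub>C x"
    and scaleC_scaleC: "c *\<^sub>C d *\<^sub>C x = (c * d) *\<^sub>C x"
    and scaleC_one: "1 *\<^sub>C x = x"

text \<open>The class \<open>ring\<close> has no unit, so these algebras are not necessarily unital.\<close>

class complex_star_algebra = complex_vector + ring +
  fixes star :: "'a \<Rightarrow> 'a"
  assumes mult_scaleC_left: "(c *\<^sub>C x) * y = c *\<^sub>C (x * y)"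
    and mult_scaleC_right: "x * (c *\<^sub>C y) = c *\<^sub>C (x * y)"
    and star_star: "star (star x) = x"
    and star_add: "star (x + y) = star x + star y"
    and star_scaleC: "star (c *\<^sub>C x) = cnj c *\<^sub>C star x"
    and star_mult: "star (x * y) = star y * star x"

text \<open>The complex inner product is linear in the first variable. Its real part is the real
  inner product of \<open>real_inner\<close>, so norm, topology and positive definiteness come from there:
  \<open>cinner x x\<close> is real by conjugate symmetry, hence equal to the squared norm of \<open>x\<close>.\<close>

class complex_inner = complex_vector + real_inner +
  fixes cinner :: "'a \<Rightarrow> 'a \<Rightarrow> complex"
  assumes scaleR_scaleC: "scaleR r x = complex_of_real r *\<^sub>C x"
    and inner_Re_cinner: "inner x y = Re (cinner x y)"
    and cinner_commute: "cinner x y = cnj (cinner y x)"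
    and cinner_add_left: "cinner (x + y) z = cinner x z + cinner y z"
    and cinner_scaleC_left: "cinner (c *\<^sub>C x) y = c * cinner x y"

class chilbert_space = complex_inner + complete_space

text \<open>The Hilbert space direct sum of two Hilbert spaces is their product type; the library
  already provides its real inner product, norm and completeness.\<close>

instantiation prod :: (complex_vector, complex_vector) complex_vector
begin
definition scaleC_prod :: "complex \<Rightarrow> 'a \<times> 'b \<Rightarrow> 'a \<times> 'b"
  where "scaleC_prod c x = (c *\<^sub>C fst x, c *\<^sub>C snd x)"
instance
  by standard
    (simp_all add: scaleC_prod_def prod_eq_iff scaleC_add_right scaleC_add_left
      scaleC_scaleC scaleC_one)
end

instantiation prod :: (complex_inner, complex_inner) complex_inner
begin
definition cinner_prod :: "'a \<times> 'b \<Rightarrow> 'a \<times> 'b \<Rightarrow> complex"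
  where "cinner_prod x y = cinner (fst x) (fst y) + cinner (snd x) (snd y)"
instance
proof
  fix r :: real and c :: complex and x y z :: "'a \<times> 'b"
  show "scaleR r x = complex_of_real r *\<^sub>C x"
    by (simp add: scaleC_prod_def prod_eq_iff scaleR_scaleC)
  show "inner x y = Re (cinner x y)"
    by (simp add: cinner_prod_def inner_prod_def inner_Re_cinner)
  show "cinner x y = cnj (cinner y x)"
    unfolding cinner_prod_def complex_cnj_add by (metis cinner_commute)
  show "cinner (x + y) z = cinner x z + cinner y z"
    by (simp add: cinner_prod_def cinner_add_left)
  show "cinner (c *\<^sub>C x) y = c * cinner x y"
    by (simp add: cinner_prod_def scaleC_prod_def cinner_scaleC_left distrib_left)
qed
end

instance prod :: (chilbert_space, chilbert_space) chilbert_space ..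

abbreviation clinear :: "('a::complex_vector \<Rightarrow> 'b::complex_vector) \<Rightarrow> bool"
  where "clinear \<equiv> Vector_Spaces.linear scaleC scaleC"

abbreviation clinear_functional :: "('a::complex_vector \<Rightarrow> complex) \<Rightarrow> bool"
  where "clinear_functional \<equiv> Vector_Spaces.linear scaleC (*)"

abbreviation csubspace :: "'a::complex_vector set \<Rightarrow> bool"
  where "csubspace \<equiv> module.subspace scaleC"

definition positive_functional :: "('a::complex_star_algebra \<Rightarrow> complex) \<Rightarrow> bool"
  where "positive_functional f \<longleftrightarrow>
    clinear_functional f \<and> (\<forall>a. f (star a * a) \<in> \<real>\<^sub>\<ge>\<^sub>0)"

text \<open>The last clause says that \<open>\<pi> (star a)\<close> is the adjoint of \<open>\<pi> a\<close>.\<close>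

definition star_representation ::
    "('a::complex_star_algebra \<Rightarrow> 'h::chilbert_space \<Rightarrow> 'h) \<Rightarrow> bool"
  where "star_representation \<pi> \<longleftrightarrow>
    (\<forall>a. clinear (\<pi> a) \<and> bounded_linear (\<pi> a)) \<and>
    (\<forall>x. clinear (\<lambda>a. \<pi> a x)) \<and>
    (\<forall>a b. \<pi> (a * b) = \<pi> a \<circ> \<pi> b) \<and>
    (\<forall>a x y. cinner (\<pi> a x) y = cinner x (\<pi> (star a) y))"

text \<open>HOL cannot quantify existentially over types, so the type of the representing Hilbert
  space is an explicit argument. As a premise with an otherwise unused type variable,
  \<open>representable TYPE('h) f\<close> expresses representability on some Hilbert space.\<close>

definition representable ::
    "'h::chilbert_space itself \<Rightarrow> ('a::complex_star_algebra \<Rightarrow> complex) \<Rightarrow> bool"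
  where "representable _ f \<longleftrightarrow> clinear_functional f \<and>
    (\<exists>(\<pi> :: 'a \<Rightarrow> 'h \<Rightarrow> 'h) \<zeta>. star_representation \<pi> \<and> (\<forall>a. f a = cinner (\<pi> a \<zeta>) \<zeta>))"

definition gns_triple ::
    "('a::complex_star_algebra \<Rightarrow> complex) \<Rightarrow> ('a \<Rightarrow> 'h::chilbert_space \<Rightarrow> 'h) \<Rightarrow> 'h \<Rightarrow> bool"
  where "gns_triple f \<pi> \<zeta> \<longleftrightarrow> star_representation \<pi> \<and>
    closure (range (\<lambda>a. \<pi> a \<zeta>)) = UNIV \<and>
    (\<forall>a. f a = cinner (\<pi> a \<zeta>) \<zeta>)"

definition rep_sum :: "('a \<Rightarrow> 'h \<Rightarrow> 'h) \<Rightarrow> ('a \<Rightarrow> 'k \<Rightarrow> 'k) \<Rightarrow> 'a \<Rightarrow> 'h \<times> 'k \<Rightarrow> 'h \<times> 'k"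
  where "rep_sum \<pi> \<rho> a = map_prod (\<pi> a) (\<rho> a)"

definition invariant_subspace :: "('a \<Rightarrow> 'h::complex_vector \<Rightarrow> 'h) \<Rightarrow> 'h set \<Rightarrow> bool"
  where "invariant_subspace \<pi> M \<longleftrightarrow> csubspace M \<and> (\<forall>a. \<pi> a ` M \<subseteq> M)"

definition orth_complement :: "'h::complex_inner set \<Rightarrow> 'h set"
  where "orth_complement M = {x. \<forall>y\<in>M. cinner x y = 0}"

text \<open>The value is determined when \<open>N\<close> is a closed complex subspace of a Hilbert space.\<close>

definition orth_projection :: "'h::complex_inner set \<Rightarrow> 'h \<Rightarrow> 'h"
  where "orth_projection N x = (THE p. p \<in> N \<and> x - p \<in> orth_complement N)"

definition diag_closure ::
    "('a \<Rightarrow> 'h::chilbert_space \<Rightarrow> 'h) \<Rightarrow> 'h \<Rightarrow> ('a \<Rightarrow> 'k::chilbert_space \<Rightarrow> 'k) \<Rightarrow> 'k \<Rightarrow>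
      ('h \<times> 'k) set"
  where "diag_closure \<pi>f \<zeta>f \<pi>g \<zeta>g = closure (range (\<lambda>a. (\<pi>f a \<zeta>f, \<pi>g a \<zeta>g)))"

text \<open>The functional \<open>f:g\<close>, built from GNS triples of \<open>f\<close> and \<open>g\<close>.\<close>

definition parallel_sum ::
    "('a \<Rightarrow> 'h::chilbert_space \<Rightarrow> 'h) \<Rightarrow> 'h \<Rightarrow> ('a \<Rightarrow> 'k::chilbert_space \<Rightarrow> 'k) \<Rightarrow> 'k \<Rightarrow>
      'a \<Rightarrow> complex"
  where "parallel_sum \<pi>f \<zeta>f \<pi>g \<zeta>g a =
    (let \<xi> = orth_projection (orth_complement (diag_closure \<pi>f \<zeta>f \<pi>g \<zeta>g)) (\<zeta>f, 0)
     in cinner (rep_sum \<pi>f \<pi>g a \<xi>) \<xi>)"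

end

theory Submission
  imports Defs
begin

text \<open>The vector \<open>P (\<zeta>f, 0)\<close> lies in the invariant subspace orthogonal to the closure \<open>M\<close> of the
  diagonal, and \<open>(\<zeta>f, 0) - P (\<zeta>f, 0)\<close> lies in the invariant subspace \<open>M\<close>. Applying \<open>\<pi> a\<close> to
  both shows that \<open>\<pi> a (P (\<zeta>f, 0))\<close> is the component of \<open>(\<pi>f a \<zeta>f, 0)\<close> orthogonal to \<open>M\<close>, so its
  squared norm is the squared distance of \<open>(\<pi>f a \<zeta>f, 0)\<close> to the diagonal, which is the infimum.\<close>

interpretation cvec: vector_space "scaleC :: complex \<Rightarrow> 'a::complex_vector \<Rightarrow> 'a"
  by unfold_locales (simp_all add: scaleC_add_right scaleC_add_left scaleC_scaleC scaleC_one)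

section \<open>Nearest points and orthogonality for closed real subspaces\<close>

text \<open>By the parallelogram law, two almost nearest points of \<open>S\<close> are close to
  each other. The sets \<open>C n\<close> of almost nearest points are therefore nested, closed and
  nonempty with diameters tending to zero, and completeness gives them a common point.\<close>

lemma nearest_point_closed_subspace:
  fixes S :: "'a::{real_inner, complete_space} set"
  assumes "closed S" and "subspace S"
  shows "\<exists>p\<in>S. \<forall>y\<in>S. norm (x - p) \<le> norm (x - y)"
proof -
  define D where "D = (INF y\<in>S. (norm (x - y))\<^sup>2)"
  \<comment> \<open>The slack \<open>1 / real (Suc n)\<close> over the squared distance
    \<open>D\<close> is positive, which keeps each \<open>C n\<close> nonempty, and tends to zero,
    which forces a common point to attain \<open>D\<close>.\<close>
  define C where "C n = {y \<in> S. (norm (x - y))\<^sup>2 \<le> D + 1 / real (Suc n)}" for n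
  have ne: "S \<noteq> {}"
    using subspace_0[OF assms(2)] by auto
  have bdd: "bdd_below ((\<lambda>y. (norm (x - y))\<^sup>2) ` S)"
    by (rule bdd_belowI[of _ 0]) auto
  have D_le: "D \<le> (norm (x - y))\<^sup>2" if "y \<in> S" for y
    unfolding D_def using bdd that by (rule cINF_lower)
  have close: "(norm (y - z))\<^sup>2 \<le> 4 / real (Suc n)" if "y \<in> C n" "z \<in> C n" for y z n
  proof -
    have "(1/2) *\<^sub>R (y + z) \<in> S"
      using that assms(2) by (auto simp: C_def intro: subspace_add subspace_scale)
    then have "D \<le> (norm (x - (1/2) *\<^sub>R (y + z)))\<^sup>2"
      by (rule D_le)
    \<comment> \<open>This is the parallelogram law for \<open>x - y\<close> and
      \<open>x - z\<close>, with their sum written as twice the difference of \<open>x\<close> and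
      the midpoint. The midpoint lies in \<open>S\<close>, so the subtracted term is at least
      \<open>4 * D\<close>.\<close>
    moreover have "(norm (y - z))\<^sup>2 = 2 * (norm (x - y))\<^sup>2 + 2 * (norm (x - z))\<^sup>2
        - 4 * (norm (x - (1/2) *\<^sub>R (y + z)))\<^sup>2"
      by (simp add: power2_norm_eq_inner inner_simps inner_commute algebra_simps)
    ultimately show ?thesis
      using that by (simp add: C_def)
  qed
  have "\<exists>p. \<Inter>(range C) = {p}"
  proof (rule decreasing_closed_nest_sing)
    show "closed (C n)" for n
      unfolding C_def Collect_conj_eq using assms(1)
      by (auto intro!: closed_Int closed_Collect_le continuous_intros)
    show "C n \<noteq> {}" for n
    proof -
      have "(INF y\<in>S. (norm (x - y))\<^sup>2) < D + 1 / real (Suc n)"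
        by (simp add: D_def)
      then show ?thesis
        using cINF_less_iff[OF ne bdd] by (auto simp: C_def intro: less_imp_le)
    qed
    show "C n \<subseteq> C m" if "m \<le> n" for m n
    proof -
      have "1 / real (Suc n) \<le> 1 / real (Suc m)"
        using that by (simp add: frac_le)
      then show ?thesis by (auto simp: C_def)
    qed
    show "\<exists>n. \<forall>y\<in>C n. \<forall>z\<in>C n. dist y z < e" if "0 < e" for e
    proof -
      have "0 < e\<^sup>2 / 4" using that by simp
      then obtain n where "1 / real (Suc n) < e\<^sup>2 / 4"
        using nat_approx_posE by blast
      then have "(dist y z)\<^sup>2 < e\<^sup>2" if "y \<in> C n" "z \<in> C n" for y z
        using close[OF that] by (simp add: dist_norm)
      then show ?thesis
        using \<open>0 < e\<close> by (meson less_imp_le power_less_imp_less_base)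
    qed
  qed
  then obtain p where p: "p \<in> C n" for n
    by blast
  have "(norm (x - p))\<^sup>2 \<le> D"
  proof (rule field_le_epsilon)
    fix e :: real assume "0 < e"
    then obtain n where "1 / real (Suc n) < e"
      using nat_approx_posE by blast
    then show "(norm (x - p))\<^sup>2 \<le> D + e"
      using p[of n] by (simp add: C_def)
  qed
  then have "norm (x - p) \<le> norm (x - y)" if "y \<in> S" for y
    using D_le[OF that] by (meson norm_ge_zero order_trans power2_le_imp_le)
  then show ?thesis
    using p[of 0] by (auto simp: C_def)
qed

text \<open>Moving from the nearest point \<open>p\<close> along a direction \<open>y\<close> in
  \<open>S\<close> cannot shorten the distance to \<open>x\<close>; a nonzero component of
  \<open>x - p\<close> along \<open>y\<close> would allow this.\<close>

lemma orthogonal_decomposition_closed_subspace: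
  fixes S :: "'a::{real_inner, complete_space} set"
  assumes "closed S" and "subspace S"
  shows "\<exists>p\<in>S. \<forall>y\<in>S. inner (x - p) y = 0"
proof -
  obtain p where p: "p \<in> S" and le: "\<And>y. y \<in> S \<Longrightarrow> norm (x - p) \<le> norm (x - y)"
    using nearest_point_closed_subspace[OF assms, of x] by blast
  have "inner (x - p) y = 0" if "y \<in> S" for y
  proof (cases "y = 0")
    case False
    \<comment> \<open>This \<open>t\<close> minimises the quadratic polynomial
      \<open>t \<mapsto> (norm ((x - p) - t *\<^sub>R y))\<^sup>2\<close>. At the minimum its value
      drops by \<open>(inner (x - p) y)\<^sup>2 / inner y y\<close>, so that quotient must
      vanish.\<close>
    define t where "t = inner (x - p) y / inner y y"
    have "p + t *\<^sub>R y \<in> S"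
      using p that assms(2) by (auto intro: subspace_add subspace_scale)
    then have "(norm (x - p))\<^sup>2 \<le> (norm (x - (p + t *\<^sub>R y)))\<^sup>2"
      using le by (simp add: power_mono)
    also have "x - (p + t *\<^sub>R y) = (x - p) - t *\<^sub>R y" by simp
    also have "(norm ((x - p) - t *\<^sub>R y))\<^sup>2
        = (norm (x - p))\<^sup>2 - 2 * t * inner (x - p) y + t\<^sup>2 * inner y y"
      by (simp add: power2_norm_eq_inner inner_diff_left inner_diff_right inner_commute)
        (simp add: power2_eq_square algebra_simps)
    also have "\<dots> = (norm (x - p))\<^sup>2 - (inner (x - p) y)\<^sup>2 / inner y y"
      using False by (simp add: t_def power2_eq_square)
    finally show ?thesis
      using False inner_gt_zero_iff[of y] by (simp add: divide_le_0_iff del: inner_gt_zero_iff)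
  qed simp
  then show ?thesis using p by blast
qed

section \<open>Complex inner products, norms and closures of complex subspaces\<close>

lemma cinner_scaleC_right: "cinner x (c *\<^sub>C y) = cnj c * cinner x y"
  unfolding cinner_commute[of x] by (simp add: cinner_scaleC_left)

lemma cinner_zero_left: "cinner 0 x = 0"
  using cinner_add_left[of 0 0 x] by simp

lemma cinner_self: "cinner x x = complex_of_real ((norm x)\<^sup>2)"
proof (rule complex_eqI)
  show "Im (cinner x x) = Im (complex_of_real ((norm x)\<^sup>2))"
    using cinner_commute[of x x] by (simp add: complex_eq_iff)
qed (simp add: power2_norm_eq_inner inner_Re_cinner)

text \<open>The norm is inherited from the real inner product, so homogeneity under complex scalars
  has to be derived from sesquilinearity of \<open>cinner\<close>, by comparing squares.\<close>

lemma norm_scaleC: "norm (c *\<^sub>C x) = cmod c * norm (x::'a::complex_inner)"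
proof -
  have "complex_of_real ((norm (c *\<^sub>C x))\<^sup>2) = complex_of_real ((cmod c)\<^sup>2 * (norm x)\<^sup>2)"
    unfolding of_real_mult cinner_self[symmetric] complex_norm_square
    by (simp add: cinner_scaleC_left cinner_scaleC_right)
  then show ?thesis
    by (simp only: of_real_eq_iff flip: power_mult_distrib) (simp add: power2_eq_iff_nonneg)
qed

lemma bounded_linear_scaleC: "bounded_linear ((*\<^sub>C) c :: 'a::complex_inner \<Rightarrow> 'a)"
proof (rule bounded_linear_intro)
  show "norm (c *\<^sub>C x) \<le> norm x * cmod c" for x :: 'a
    by (simp add: norm_scaleC mult.commute)
qed (simp_all add: scaleC_add_right scaleR_scaleC scaleC_scaleC mult.commute)

lemma csubspace_closure:
  fixes S :: "'a::complex_inner set"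
  assumes "csubspace S"
  shows "csubspace (closure S)"
proof (rule cvec.subspaceI)
  show "0 \<in> closure S"
    using cvec.subspace_0[OF assms] closure_subset by blast
  show "x + y \<in> closure S" if "x \<in> closure S" "y \<in> closure S" for x y
  proof -
    \<comment> \<open>Addition is treated as one continuous map on the product, because the closure
      of \<open>S \<times> S\<close> is the product of the closures.\<close>
    have "(\<lambda>z. fst z + snd z) ` closure (S \<times> S) \<subseteq> closure S"
    proof (rule image_closure_subset)
      show "(\<lambda>z. fst z + snd z) ` (S \<times> S) \<subseteq> closure S"
        using cvec.subspace_add[OF assms] closure_subset by force
    qed (auto intro!: continuous_intros)
    then show ?thesis
      using that by (force simp: closure_Times)
  qed
  show "c *\<^sub>C x \<in> closure S" if "x \<in> closure S" for c x
  proof -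
    have "(*\<^sub>C) c ` closure S \<subseteq> closure S"
    proof (rule image_closure_subset)
      show "continuous_on (closure S) ((*\<^sub>C) c)"
        by (rule linear_continuous_on[OF bounded_linear_scaleC])
      show "(*\<^sub>C) c ` S \<subseteq> closure S"
        using cvec.subspace_scale[OF assms] closure_subset by force
    qed simp
    then show ?thesis using that by blast
  qed
qed

lemma csubspace_imp_subspace: "csubspace S \<Longrightarrow> subspace (S :: 'a::complex_inner set)"
  unfolding subspace_def
  by (auto simp: scaleR_scaleC intro: cvec.subspace_0 cvec.subspace_add cvec.subspace_scale)

section \<open>Orthogonal decomposition and projection in complex Hilbert spaces\<close>

lemma orthogonal_decomposition:
  fixes M :: "'h::chilbert_space set"
  assumes "closed M" and "csubspace M"
  shows "\<exists>p\<in>orth_complement M. x - p \<in> M"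
proof -
  obtain m where m: "m \<in> M" and orth: "\<And>y. y \<in> M \<Longrightarrow> inner (x - m) y = 0"
    using orthogonal_decomposition_closed_subspace[OF assms(1) csubspace_imp_subspace[OF assms(2)]]
    by blast
  \<comment> \<open>Real orthogonality to \<open>y\<close> kills the real part. Orthogonality to
    \<open>\<i> *\<^sub>C y\<close>, which also lies in \<open>M\<close>, kills the imaginary
    part.\<close>
  have "cinner (x - m) y = 0" if "y \<in> M" for y
    using orth[OF that] orth[OF cvec.subspace_scale[OF assms(2) that, of \<i>]]
    by (simp add: inner_Re_cinner cinner_scaleC_right complex_eq_iff)
  then show ?thesis
    using m by (intro bexI[of _ "x - m"]) (auto simp: orth_complement_def)
qed

lemma csubspace_orth_complement: "csubspace (orth_complement M)"
  by (rule cvec.subspaceI)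
    (simp_all add: orth_complement_def cinner_zero_left cinner_add_left cinner_scaleC_left)

text \<open>\<open>M\<close> is contained in its double complement, so \<open>p\<close> meets the
  defining condition. Two candidates differ by a vector of both the complement and the double
  complement, which is orthogonal to itself.\<close>

lemma orth_projection_orth_complement_eqI:
  assumes "p \<in> orth_complement M" and "x - p \<in> M"
  shows "orth_projection (orth_complement M) x = p"
  unfolding orth_projection_def
proof (rule the_equality)
  have "cinner (x - p) y = 0" if "y \<in> orth_complement M" for y
    using that assms(2) cinner_commute[of "x - p" y] by (simp add: orth_complement_def)
  then have xp: "x - p \<in> orth_complement (orth_complement M)"
    by (auto simp: orth_complement_def)
  then show "p \<in> orth_complement M \<and> x - p \<in> orth_complement (orth_complement M)"
    using assms(1) by simp
  fix q assume q: "q \<in> orth_complement M \<and> x - q \<in> orth_complement (orth_complement M)"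
  have "q - p \<in> orth_complement M"
    using q assms(1) by (blast intro: cvec.subspace_diff[OF csubspace_orth_complement])
  moreover have "(x - p) - (x - q) \<in> orth_complement (orth_complement M)"
    using q xp by (blast intro: cvec.subspace_diff[OF csubspace_orth_complement])
  ultimately have "cinner (q - p) (q - p) = 0"
    by (simp add: orth_complement_def[of "orth_complement M"])
  then show "q = p" by (simp add: cinner_self)
qed

section \<open>Invariant subspaces of a star representation\<close>

lemma invariant_subspace_closure:
  fixes \<pi> :: "'a::complex_star_algebra \<Rightarrow> 'h::chilbert_space \<Rightarrow> 'h"
  assumes "star_representation \<pi>" and "invariant_subspace \<pi> S"
  shows "invariant_subspace \<pi> (closure S)"
  unfolding invariant_subspace_def
proof (intro conjI allI)
  show "csubspace (closure S)"
    using assms(2) by (simp add: invariant_subspace_def csubspace_closure)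
  fix a
  show "\<pi> a ` closure S \<subseteq> closure S"
  proof (rule image_closure_subset)
    show "continuous_on (closure S) (\<pi> a)"
      using assms(1) by (intro linear_continuous_on) (simp add: star_representation_def)
    show "\<pi> a ` S \<subseteq> closure S"
      using assms(2) closure_subset unfolding invariant_subspace_def by blast
  qed simp
qed

text \<open>Passing to the adjoint moves \<open>\<pi> a\<close> to the other argument as
  \<open>\<pi> (star a)\<close>, which maps \<open>M\<close> into itself.\<close>

lemma invariant_subspace_orth_complement:
  fixes \<pi> :: "'a::complex_star_algebra \<Rightarrow> 'h::chilbert_space \<Rightarrow> 'h"
  assumes "star_representation \<pi>" and "invariant_subspace \<pi> M"
  shows "invariant_subspace \<pi> (orth_complement M)"
  unfolding invariant_subspace_def
proof (intro conjI allI csubspace_orth_complement)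
  fix a
  have "cinner (\<pi> a x) y = 0" if "x \<in> orth_complement M" "y \<in> M" for x y
  proof -
    have "\<pi> (star a) y \<in> M"
      using assms(2) that(2) by (auto simp: invariant_subspace_def)
    then show ?thesis
      using assms(1) that(1) by (simp add: star_representation_def orth_complement_def)
  qed
  then show "\<pi> a ` orth_complement M \<subseteq> orth_complement M"
    by (auto simp: orth_complement_def)
qed

lemma invariant_subspace_orbit:
  assumes "star_representation \<pi>"
  shows "invariant_subspace \<pi> (range (\<lambda>a. \<pi> a \<zeta>))"
  unfolding invariant_subspace_def
proof (intro conjI allI)
  interpret orbit: Vector_Spaces.linear scaleC scaleC "\<lambda>a. \<pi> a \<zeta>"
    using assms by (simp add: star_representation_def)
  show "csubspace (range (\<lambda>a. \<pi> a \<zeta>))"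
    by (rule orbit.subspace_image[OF cvec.subspace_UNIV])
  show "\<pi> a ` range (\<lambda>a. \<pi> a \<zeta>) \<subseteq> range (\<lambda>a. \<pi> a \<zeta>)" for a
  proof -
    have "\<pi> a (\<pi> b \<zeta>) = \<pi> (a * b) \<zeta>" for b
      using assms by (simp add: star_representation_def)
    then show ?thesis by auto
  qed
qed

section \<open>Linear maps and direct sums of representations\<close>

lemma clinearI:
  assumes "\<And>x y. T (x + y) = T x + T y" and "\<And>c x. T (c *\<^sub>C x) = c *\<^sub>C T x"
  shows "clinear T"
  by unfold_locales (simp_all add: assms)

lemma clinear_add: "clinear T \<Longrightarrow> T (x + y) = T x + T y"
  by (auto simp: Vector_Spaces.linear_def dest: module_hom.add)

lemma clinear_scaleC: "clinear T \<Longrightarrow> T (c *\<^sub>C x) = c *\<^sub>C T x"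
  by (auto simp: Vector_Spaces.linear_def dest: module_hom.scale)

lemma clinear_map_prod:
  assumes "clinear S" and "clinear T"
  shows "clinear (map_prod S T)"
proof (rule clinearI)
  show "map_prod S T (x + y) = map_prod S T x + map_prod S T y" for x y
    by (simp add: prod_eq_iff clinear_add[OF assms(1)] clinear_add[OF assms(2)])
  show "map_prod S T (c *\<^sub>C x) = c *\<^sub>C map_prod S T x" for c x
    by (simp add: prod_eq_iff scaleC_prod_def clinear_scaleC[OF assms(1)] clinear_scaleC[OF assms(2)])
qed

lemma bounded_linear_map_prod:
  assumes "bounded_linear S" and "bounded_linear T"
  shows "bounded_linear (map_prod S T)"
  unfolding map_prod_def case_prod_beta
  by (intro bounded_linear_Pair bounded_linear_compose[OF assms(1)]
      bounded_linear_compose[OF assms(2)] bounded_linear_fst bounded_linear_snd)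

lemma star_representation_rep_sum:
  assumes "star_representation \<pi>" and "star_representation \<rho>"
  shows "star_representation (rep_sum \<pi> \<rho>)"
proof -
  have lin: "clinear (\<lambda>a. rep_sum \<pi> \<rho> a x)" for x
  proof (rule clinearI)
    have 1: "clinear (\<lambda>a. \<pi> a (fst x))" and 2: "clinear (\<lambda>a. \<rho> a (snd x))"
      using assms by (simp_all add: star_representation_def)
    show "rep_sum \<pi> \<rho> (a + b) x = rep_sum \<pi> \<rho> a x + rep_sum \<pi> \<rho> b x" for a b
      by (simp add: rep_sum_def prod_eq_iff clinear_add[OF 1] clinear_add[OF 2])
    show "rep_sum \<pi> \<rho> (c *\<^sub>C a) x = c *\<^sub>C rep_sum \<pi> \<rho> a x" for c a
      by (simp add: rep_sum_def prod_eq_iff scaleC_prod_def clinear_scaleC[OF 1] clinear_scaleC[OF 2])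
  qed
  show ?thesis
    unfolding star_representation_def
  proof (intro conjI allI lin)
    fix a b x y
    show "clinear (rep_sum \<pi> \<rho> a)" and "bounded_linear (rep_sum \<pi> \<rho> a)"
      using assms unfolding rep_sum_def star_representation_def
      by (blast intro: clinear_map_prod bounded_linear_map_prod)+
    show "rep_sum \<pi> \<rho> (a * b) = rep_sum \<pi> \<rho> a \<circ> rep_sum \<pi> \<rho> b"
      using assms by (simp add: rep_sum_def star_representation_def map_prod.comp)
    show "cinner (rep_sum \<pi> \<rho> a x) y = cinner x (rep_sum \<pi> \<rho> (star a) y)"
      using assms by (simp add: rep_sum_def star_representation_def cinner_prod_def)
  qed
qed

section \<open>Vector functionals and the distance to a subspace\<close>

lemma representable_vector_functional:
  fixes \<pi> :: "'a::complex_star_algebra \<Rightarrow> 'h::chilbert_space \<Rightarrow> 'h"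
  assumes "star_representation \<pi>"
  shows "representable TYPE('h) (\<lambda>a. cinner (\<pi> a \<xi>) \<xi>)"
proof -
  have lin: "clinear (\<lambda>a. \<pi> a \<xi>)"
    using assms by (simp add: star_representation_def)
  have "clinear_functional (\<lambda>a. cinner (\<pi> a \<xi>) \<xi>)"
    by unfold_locales
      (simp_all add: clinear_add[OF lin] clinear_scaleC[OF lin] cinner_add_left
        cinner_scaleC_left algebra_simps)
  then show ?thesis
    using assms unfolding representable_def by blast
qed

text \<open>This turns values of \<open>f\<close>, \<open>g\<close> and the parallel sum at elements
  \<open>star a * a\<close> into squared norms, so that the claim becomes a statement about
  distances.\<close>

lemma vector_functional_star_mult:
  assumes "star_representation \<pi>"
  shows "cinner (\<pi> (star a * a) \<xi>) \<xi> = complex_of_real ((norm (\<pi> a \<xi>))\<^sup>2)"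
  using assms by (simp add: star_representation_def star_star cinner_self)

text \<open>By Pythagoras, each squared distance from \<open>u\<close> to \<open>d b\<close> exceeds
  the squared norm of \<open>p\<close> by the squared distance from \<open>u - p\<close> to
  \<open>d b\<close>. The latter becomes arbitrarily small because \<open>u - p\<close> is a limit
  of points of \<open>range d\<close>; the infimum need not be attained.\<close>

lemma norm_orthogonal_component_eq_INF:
  fixes u p :: "'h::complex_inner" and d :: "'b \<Rightarrow> 'h"
  assumes "csubspace (closure (range d))"
    and "p \<in> orth_complement (closure (range d))" and "u - p \<in> closure (range d)"
  shows "(norm p)\<^sup>2 = (INF b. (norm (u - d b))\<^sup>2)"
proof (rule sym, rule cInf_eq_non_empty)
  have pyth: "(norm (u - d b))\<^sup>2 = (norm p)\<^sup>2 + (norm ((u - p) - d b))\<^sup>2" for b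
  proof -
    have "(u - p) - d b \<in> closure (range d)"
      using closure_subset[of "range d"] by (intro cvec.subspace_diff[OF assms(1) assms(3)]) auto
    then have "inner p ((u - p) - d b) = 0"
      using assms(2) by (simp add: orth_complement_def inner_Re_cinner)
    then have "(norm (p + ((u - p) - d b)))\<^sup>2 = (norm p)\<^sup>2 + (norm ((u - p) - d b))\<^sup>2"
      by (simp only: power2_norm_eq_inner inner_add_left inner_add_right
          inner_commute[of "(u - p) - d b" p] add_0_left add_0_right)
    then show ?thesis by simp
  qed
  show "(norm p)\<^sup>2 \<le> z" if "z \<in> range (\<lambda>b. (norm (u - d b))\<^sup>2)" for z
    using that pyth by auto
  show "y \<le> (norm p)\<^sup>2" if lower: "\<And>z. z \<in> range (\<lambda>b. (norm (u - d b))\<^sup>2) \<Longrightarrow> y \<le> z" for y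
  proof (rule field_le_epsilon)
    fix e :: real assume "0 < e"
    then obtain b where "dist (d b) (u - p) < sqrt e"
      using assms(3) by (auto simp: closure_approachable dest: spec[of _ "sqrt e"])
    then have "norm ((u - p) - d b) < sqrt e"
      by (simp add: dist_norm norm_minus_commute)
    then have "(norm ((u - p) - d b))\<^sup>2 < (sqrt e)\<^sup>2"
      by (intro power_strict_mono) auto
    then have "(norm (u - d b))\<^sup>2 \<le> (norm p)\<^sup>2 + e"
      using \<open>0 < e\<close> by (simp add: pyth)
    then show "y \<le> (norm p)\<^sup>2 + e"
      using lower[of "(norm (u - d b))\<^sup>2"] by auto
  qed
qed simp

theorem theorem5p1:
  fixes f g :: "'a::complex_star_algebra \<Rightarrow> complex"
    and \<pi>f :: "'a \<Rightarrow> 'hf::chilbert_space \<Rightarrow> 'hf" and \<zeta>f :: 'hf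
    and \<pi>g :: "'a \<Rightarrow> 'hg::chilbert_space \<Rightarrow> 'hg" and \<zeta>g :: 'hg
  assumes "positive_functional f" and "representable TYPE('k::chilbert_space) f"
    and "positive_functional g" and "representable TYPE('l::chilbert_space) g"
    and "gns_triple f \<pi>f \<zeta>f" and "gns_triple g \<pi>g \<zeta>g"
  shows "invariant_subspace (rep_sum \<pi>f \<pi>g) (diag_closure \<pi>f \<zeta>f \<pi>g \<zeta>g) \<and>
    representable TYPE('hf \<times> 'hg) (parallel_sum \<pi>f \<zeta>f \<pi>g \<zeta>g) \<and>
    (\<forall>a. parallel_sum \<pi>f \<zeta>f \<pi>g \<zeta>g (star a * a) =
      complex_of_real (INF b. Re (f (star (a - b) * (a - b)) + g (star b * b))))"
proof -
  define \<pi> where "\<pi> = rep_sum \<pi>f \<pi>g"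
  define d where "d b = (\<pi>f b \<zeta>f, \<pi>g b \<zeta>g)" for b
  define M where "M = diag_closure \<pi>f \<zeta>f \<pi>g \<zeta>g"
  have repf: "star_representation \<pi>f" and repg: "star_representation \<pi>g"
    using assms(5,6) by (simp_all add: gns_triple_def)
  have f: "f = (\<lambda>a. cinner (\<pi>f a \<zeta>f) \<zeta>f)" and g: "g = (\<lambda>a. cinner (\<pi>g a \<zeta>g) \<zeta>g)"
    using assms(5,6) by (auto simp: gns_triple_def)
  have rep: "star_representation \<pi>"
    unfolding \<pi>_def by (rule star_representation_rep_sum[OF repf repg])
  \<comment> \<open>The diagonal is the orbit of the single vector
    \<open>(\<zeta>f, \<zeta>g)\<close> under \<open>\<pi>\<close>, so the general facts on orbits
    apply to it.\<close>
  have d: "d = (\<lambda>b. \<pi> b (\<zeta>f, \<zeta>g))"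
    by (simp add: d_def \<pi>_def rep_sum_def fun_eq_iff)
  have M: "M = closure (range d)"
    by (simp add: M_def diag_closure_def d_def)
  have inv: "invariant_subspace \<pi> M"
    unfolding M d by (intro invariant_subspace_closure invariant_subspace_orbit rep)
  then have sub: "csubspace M"
    by (simp add: invariant_subspace_def)
  have "closed M"
    by (simp add: M)
  \<comment> \<open>This \<open>\<xi>\<close> is the projection of \<open>(\<zeta>f, 0)\<close> onto
    the complement of \<open>M\<close>, that is, the vector representing the parallel sum.\<close>
  then obtain \<xi> where \<xi>: "\<xi> \<in> orth_complement M" "(\<zeta>f, 0) - \<xi> \<in> M"
    using orthogonal_decomposition[OF _ sub] by blast
  have sum: "parallel_sum \<pi>f \<zeta>f \<pi>g \<zeta>g = (\<lambda>a. cinner (\<pi> a \<xi>) \<xi>)"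
    using orth_projection_orth_complement_eqI[OF \<xi>]
    by (simp add: parallel_sum_def fun_eq_iff \<pi>_def M_def)
  have "cinner (\<pi> (star a * a) \<xi>) \<xi> =
      complex_of_real (INF b. Re (f (star (a - b) * (a - b)) + g (star b * b)))" for a
  proof -
    have orbit_diff: "\<pi>f (a - b) \<zeta>f = \<pi>f a \<zeta>f - \<pi>f b \<zeta>f" for b
      using repf by (intro module_hom.diff[of scaleC scaleC "\<lambda>a. \<pi>f a \<zeta>f"])
        (simp add: star_representation_def Vector_Spaces.linear_def)
    have g0: "\<pi>g a 0 = 0"
      using repg linear_simps(3) by (auto simp: star_representation_def)
    \<comment> \<open>The coordinates of the difference are \<open>\<pi>f (a - b) \<zeta>f\<close>
      and \<open>- \<pi>g b \<zeta>g\<close>; their squared norms are the two summands on the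
      right.\<close>
    have norm_diff: "(norm ((\<pi>f a \<zeta>f, 0) - d b))\<^sup>2
        = Re (f (star (a - b) * (a - b)) + g (star b * b))" for b
      by (simp add: f g vector_functional_star_mult[OF repf] vector_functional_star_mult[OF repg]
          d_def norm_Pair orbit_diff)
    have "\<pi> a \<xi> \<in> orth_complement M"
      using invariant_subspace_orth_complement[OF rep inv] \<xi>(1)
      by (auto simp: invariant_subspace_def)
    moreover have "\<pi> a ((\<zeta>f, 0) - \<xi>) \<in> M"
      using inv \<xi>(2) by (auto simp: invariant_subspace_def)
    \<comment> \<open>With the two memberships above, this exhibits \<open>\<pi> a \<xi>\<close> as
      the component of \<open>(\<pi>f a \<zeta>f, 0)\<close> orthogonal to \<open>M\<close>.\<close>
    moreover have "\<pi> a ((\<zeta>f, 0) - \<xi>) = (\<pi>f a \<zeta>f, 0) - \<pi> a \<xi>"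
    proof -
      have "bounded_linear (\<pi> a)"
        using rep by (simp add: star_representation_def)
      then have "\<pi> a ((\<zeta>f, 0) - \<xi>) = \<pi> a (\<zeta>f, 0) - \<pi> a \<xi>"
        by (rule linear_simps(2))
      then show ?thesis by (simp add: \<pi>_def rep_sum_def g0)
    qed
    ultimately have "(norm (\<pi> a \<xi>))\<^sup>2 = (INF b. (norm ((\<pi>f a \<zeta>f, 0) - d b))\<^sup>2)"
      using norm_orthogonal_component_eq_INF[of d "\<pi> a \<xi>"] sub by (simp add: M)
    then show ?thesis
      by (simp only: vector_functional_star_mult[OF rep] norm_diff)
  qed
  then show ?thesis
    using inv representable_vector_functional[OF rep, of \<xi>] unfolding sum \<pi>_def M_def by blast
qed

end
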